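(* For all integers $n\ge1$ and $s\ge0$, $$k(s,n)\ge\left\lceil\frac{s}{n+1}\right\rceil.$$ Equivalently, for all $n\ge1$, $k\ge1$, the minimal size $s$ of a universal testing set over $\mathbb{Q}$ for tropical polynomials in $n$ variables with at most $k$ monomials satisfies $s\le k(n+1)+1$.
   Context: A tropical polynomial over $\mathbb{Q}$ in $\vec{x}=(x_1,\dots,x_n)$ is a finite collection of tropical monomials $m_J(\vec{x}) = c_J + j_1x_1+\dots+j_nx_n$ with pairwise distinct exponent vectors $J=(j_1,\dots,j_n)$ and constants $c_J\in\mathbb{Q}$; its value is $p(\vec{x})=\max_J m_J(\vec{x})$. Here the exponents are allowed to be arbitrary rational numbers (this does not affect the quantities below compared with nonnegative integer exponents). A polynomial is nontrivial if it has at least one monomial. A point $\vec{a}\in\mathbb{Q}^n$ is a root of $p$ if the maximum $\max_J m_J(\vec{a})$ is attained on at least two distinct monomials; otherwise it is a non-root. $k(s,n)$ denotes the minimal number such that for any set $S$ of $s$ points in $\mathbb{Q}^n$ there is a nontrivial tropical polynomial over $\mathbb{Q}$ in $n$ variables with at most $k(s,n)$ monomials having roots in all the points of $S$. A universal testing set over $\mathbb{Q}$ for tropical polynomials of $n$ variables with at most $k$ monomials is a finite set $S\subseteq\mathbb{Q}^n$ such that every nontrivial tropical polynomial over $\mathbb{Q}$ in $n$ variables with at most $k$ monomials has a non-root in $S$. *)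

theory Defs
  imports Complex_Main "HOL-Library.FuncSet"
begin

definition rat_space :: "nat \<Rightarrow> (nat \<Rightarrow> rat) set" where
  "rat_space n = {..<n} \<rightarrow>\<^sub>E UNIV"

text \<open>A polynomial is a partial map from exponent vectors to constants, so the exponent
  vectors of its monomials are automatically pairwise distinct; \<open>dom p\<close> indexes the monomials,
  and \<open>card (dom p)\<close> is their number.\<close>

type_synonym trop_poly = "(nat \<Rightarrow> rat) \<rightharpoonup> rat"

definition is_trop_poly :: "nat \<Rightarrow> trop_poly \<Rightarrow> bool" where
  "is_trop_poly n p \<longleftrightarrow> finite (dom p) \<and> dom p \<subseteq> rat_space n"

definition nontrivial :: "trop_poly \<Rightarrow> bool" where
  "nontrivial p \<longleftrightarrow> dom p \<noteq> {}"

definition monomial_val :: "nat \<Rightarrow> trop_poly \<Rightarrow> (nat \<Rightarrow> rat) \<Rightarrow> (nat \<Rightarrow> rat) \<Rightarrow> rat" where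
  "monomial_val n p J x = the (p J) + (\<Sum>i<n. J i * x i)"

text \<open>Only meaningful for nontrivial \<open>p\<close>.\<close>

definition trop_val :: "nat \<Rightarrow> trop_poly \<Rightarrow> (nat \<Rightarrow> rat) \<Rightarrow> rat" where
  "trop_val n p x = Max ((\<lambda>J. monomial_val n p J x) ` dom p)"

definition trop_root :: "nat \<Rightarrow> trop_poly \<Rightarrow> (nat \<Rightarrow> rat) \<Rightarrow> bool" where
  "trop_root n p a \<longleftrightarrow>
     (\<exists>J \<in> dom p. \<exists>K \<in> dom p. J \<noteq> K \<and>
        monomial_val n p J a = trop_val n p a \<and> monomial_val n p K a = trop_val n p a)"

text \<open>For \<open>n \<ge> 1\<close> some number of monomials always suffices (already polynomials in
  one of the coordinates do), so the minimum exists.\<close>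

definition min_monomials :: "nat \<Rightarrow> nat \<Rightarrow> nat" where
  "min_monomials s n = (LEAST k. \<forall>S. S \<subseteq> rat_space n \<and> finite S \<and> card S = s \<longrightarrow>
     (\<exists>p. is_trop_poly n p \<and> nontrivial p \<and> card (dom p) \<le> k \<and> (\<forall>a\<in>S. trop_root n p a)))"

definition universal_testing_set :: "nat \<Rightarrow> nat \<Rightarrow> (nat \<Rightarrow> rat) set \<Rightarrow> bool" where
  "universal_testing_set n k S \<longleftrightarrow> finite S \<and> S \<subseteq> rat_space n \<and>
     (\<forall>p. is_trop_poly n p \<and> nontrivial p \<and> card (dom p) \<le> k \<longrightarrow> (\<exists>a\<in>S. \<not> trop_root n p a))"

definition min_testing_size :: "nat \<Rightarrow> nat \<Rightarrow> nat" where
  "min_testing_size n k = (LEAST s. \<exists>S. universal_testing_set n k S \<and> card S = s)"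

end

theory Submission
  imports Defs "HOL-Computational_Algebra.Polynomial" "HOL-Library.Function_Algebras"
begin

text \<open>
  Label the monomials of a polynomial by numbers below \<open>k\<close> and record the exponents and the
  constant of each label: this is a vector \<open>y\<close> in a space of dimension \<open>k * (n + 1)\<close>. That the
  monomials \<open>u\<close> and \<open>v\<close> agree at a given point is a homogeneous linear condition on \<open>y\<close>.
  The points are chosen one after another. Suppose that, for each of the finitely many ways to
  assign pairs \<open>(u, v)\<close> to the earlier points, the vectors satisfying the corresponding conditions
  form a known subspace. On such a subspace either the monomials \<open>u\<close> and \<open>v\<close> coincide identically,
  which a polynomial with distinct exponent vectors forbids, or a generic new point makes the
  condition for \<open>(u, v)\<close> cut the dimension by one. The dimension
  reaches \<open>0\<close> after \<open>k * (n + 1)\<close> points, and one more point then excludes every polynomial,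
  so \<open>k * (n + 1) + 1\<close> suitably chosen points form a universal testing set.

  The points are taken on the moment curve \<open>t \<mapsto> (t, t\<^sup>2, \<dots>, t\<^sup>n)\<close>. There the difference of two
  monomials is an ordinary polynomial in \<open>t\<close> of degree at most \<open>n\<close>, whose coefficients are the
  differences of the recorded numbers; so two different monomials agree at only finitely many
  parameters, and a generic parameter is one that avoids a finite set. The lemma
  \<open>ex_generic_parameters\<close> is the dimension argument, and \<open>ex_universal_testing_set\<close> applies it to
  the moment curve and yields testing sets of every size above \<open>k * (n + 1)\<close>. Hence
  \<open>s\<close> points that defeat all polynomials with at most \<open>k\<close> monomials exist as soon as \<open>s > k * (n + 1)\<close>,
  which bounds \<open>min_monomials\<close> from below.

  Since \<open>min_monomials\<close> is defined as a least number, the lower bound also requires that some number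
  of monomials is sufficient for all sets of \<open>s\<close> points. \<open>ex_trop_poly_vanishing\<close> supplies
  the number \<open>s + 1\<close>.
\<close>

section \<open>Generic linear conditions\<close>

text \<open>The projection along \<open>b\<close> onto the kernel of \<open>f\<close> fixes \<open>y\<close>, kills \<open>b\<close>, and maps the other
  generators to those shown. So a hyperplane section costs one generator; counting generators
  in this way replaces a computation of dimensions.\<close>

lemma (in vector_space) hyperplane_section_in_span:
  assumes "Vector_Spaces.linear scale (*) f" and "b \<in> B" "f b \<noteq> 0"
    and "y \<in> span B" "f y = 0"
  shows "y \<in> span ((\<lambda>x. x - scale (f x / f b) b) ` (B - {b}))"
proof -
  interpret f: Vector_Spaces.linear scale "(*)" f by fact
  let ?P = "\<lambda>x. x - scale (f x / f b) b"
  let ?C = "?P ` (B - {b})"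
  have "subspace {x. ?P x \<in> span ?C}"
  proof (rule subspaceI)
    show "0 \<in> {x. ?P x \<in> span ?C}"
      by (simp add: span_zero)
  next
    fix x z assume "x \<in> {x. ?P x \<in> span ?C}" "z \<in> {x. ?P x \<in> span ?C}"
    then have "?P x + ?P z \<in> span ?C" by (simp add: span_add)
    also have "?P x + ?P z = ?P (x + z)"
      by (simp add: f.add add_divide_distrib scale_left_distrib)
    finally show "x + z \<in> {x. ?P x \<in> span ?C}" by simp
  next
    fix c x assume "x \<in> {x. ?P x \<in> span ?C}"
    then have "scale c (?P x) \<in> span ?C" by (simp add: span_scale)
    also have "scale c (?P x) = ?P (scale c x)"
      by (simp add: f.scale scale_right_diff_distrib)
    finally show "scale c x \<in> {x. ?P x \<in> span ?C}" by simp
  qed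
  moreover have "B \<subseteq> {x. ?P x \<in> span ?C}"
  proof
    fix x assume "x \<in> B"
    show "x \<in> {x. ?P x \<in> span ?C}"
    proof (cases "x = b")
      case True
      then show ?thesis using \<open>f b \<noteq> 0\<close> by (simp add: span_zero)
    next
      case False
      then show ?thesis using \<open>x \<in> B\<close> by (auto intro: span_base)
    qed
  qed
  ultimately have "span B \<subseteq> {x. ?P x \<in> span ?C}"
    by (rule span_minimal[rotated])
  with \<open>y \<in> span B\<close> have "?P y \<in> span ?C" by blast
  then show ?thesis using \<open>f y = 0\<close> by simp
qed

text \<open>Here \<open>e\<close> ranges over the possible coincidences and \<open>\<phi> e t\<close> is the condition that \<open>e\<close> imposes
  at the parameter \<open>t\<close>. The conclusion says that a vector meeting a condition at every parameter
  of \<open>T\<close> meets one of them only because it does so identically in \<open>t\<close>. The induction is over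
  a whole family \<open>F\<close> of spans, as a single parameter \<open>t\<close> replaces one span by one section for each
  \<open>e\<close>, and the later parameters must work for all of these sections at once.\<close>

lemma (in vector_space) ex_generic_parameters:
  fixes \<phi> :: "'e \<Rightarrow> 't \<Rightarrow> 'b \<Rightarrow> 'a"
  assumes inf: "infinite (UNIV :: 't set)" and E: "finite E"
    and lin: "\<And>e t. e \<in> E \<Longrightarrow> Vector_Spaces.linear scale (*) (\<phi> e t)"
    and zeros: "\<And>e t y. e \<in> E \<Longrightarrow> \<phi> e t y \<noteq> 0 \<Longrightarrow> finite {t. \<phi> e t y = 0}"
    and F: "finite F" "\<And>B. B \<in> F \<Longrightarrow> finite B \<and> card B \<le> d"
  shows "\<exists>T. finite T \<and> card T \<le> Suc d \<and>
    (\<forall>B\<in>F. \<forall>y\<in>span B. \<exists>t\<in>T. \<forall>e\<in>E. \<phi> e t y = 0 \<longrightarrow> (\<forall>t'. \<phi> e t' y = 0))"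
  using F
proof (induction d arbitrary: F)
  case 0
  have "\<phi> e t 0 = 0" if "e \<in> E" for e t
  proof -
    interpret f: Vector_Spaces.linear scale "(*)" "\<phi> e t" using lin that .
    show ?thesis by simp
  qed
  moreover have "y = 0" if "B \<in> F" "y \<in> span B" for B y
  proof -
    have "B = {}" using 0(2)[OF that(1)] by (metis card_eq_0_iff le_zero_eq)
    then show ?thesis using that(2) by simp
  qed
  ultimately show ?case
    by (intro exI[of _ "{undefined}"]) fastforce
next
  case (Suc d)
  \<comment> \<open>Outside \<open>bad\<close>, a condition that does not vanish identically on a generator is
      nonzero at that generator, so its hyperplane is a proper one.\<close>
  define bad where "bad = (\<Union>B\<in>F. \<Union>b\<in>B. \<Union>e\<in>{e\<in>E. \<exists>t'. \<phi> e t' b \<noteq> 0}. {t. \<phi> e t b = 0})"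
  have "finite bad"
    unfolding bad_def using Suc.prems E zeros by (intro finite_UN_I) auto
  then obtain t where "t \<notin> bad"
    using inf ex_new_if_finite by blast
  then have t: "\<phi> e t b \<noteq> 0" if "B \<in> F" "b \<in> B" "e \<in> E" "\<phi> e t' b \<noteq> 0" for B b e t'
    using that unfolding bad_def by blast
  \<comment> \<open>The section does not depend on which generator \<open>b\<close> is eliminated, but a suitable \<open>b\<close> depends
      on \<open>B\<close> and \<open>e\<close>; taking all triples avoids choosing one. For unsuitable \<open>b\<close> the
      division by \<open>0\<close> gives harmless extra members of the family.\<close>
  define cut where
    "cut = (\<lambda>(B, b, e). (\<lambda>x. x - scale (\<phi> e t x / \<phi> e t b) b) ` (B - {b}))"
  define F' where "F' = cut ` (SIGMA B:F. B \<times> E)"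
  have "finite F'"
    unfolding F'_def using Suc.prems E by auto
  moreover have "finite C \<and> card C \<le> d" if "C \<in> F'" for C
  proof -
    from that obtain B b e where B: "B \<in> F" "b \<in> B" and C: "C = cut (B, b, e)"
      unfolding F'_def by auto
    then have "card (B - {b}) \<le> d" "finite B"
      using Suc.prems(2)[OF B(1)] by auto
    then show ?thesis
      unfolding C cut_def by (auto intro: le_trans[OF card_image_le])
  qed
  ultimately obtain T where T: "finite T" "card T \<le> Suc d"
    "\<And>C y. C \<in> F' \<Longrightarrow> y \<in> span C \<Longrightarrow> \<exists>t\<in>T. \<forall>e\<in>E. \<phi> e t y = 0 \<longrightarrow> (\<forall>t'. \<phi> e t' y = 0)"
    using Suc.IH[of F'] by blast
  have "\<exists>t\<in>insert t T. \<forall>e\<in>E. \<phi> e t y = 0 \<longrightarrow> (\<forall>t'. \<phi> e t' y = 0)"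
    if B: "B \<in> F" and y: "y \<in> span B" for B y
  proof (cases "\<exists>e\<in>E. \<phi> e t y = 0 \<and> (\<exists>t'. \<phi> e t' y \<noteq> 0)")
    case False
    then show ?thesis by auto
  next
    case True
    then obtain e t' where e: "e \<in> E" "\<phi> e t y = 0" "\<phi> e t' y \<noteq> 0" by blast
    have "\<exists>b\<in>B. \<phi> e t' b \<noteq> 0"
    proof (rule ccontr)
      interpret f: Vector_Spaces.linear scale "(*)" "\<phi> e t'" using lin e(1) .
      assume "\<not> ?thesis"
      then show False using f.eq_0_on_span[of B y] y e(3) by blast
    qed
    then obtain b where b: "b \<in> B" "\<phi> e t b \<noteq> 0"
      using t B e(1) by blast
    have "y \<in> span (cut (B, b, e))"
      unfolding cut_def prod.case
      by (rule hyperplane_section_in_span) (use lin e b y in auto)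
    moreover have "cut (B, b, e) \<in> F'"
      unfolding F'_def using B b e by auto
    ultimately show ?thesis using T(3) by blast
  qed
  moreover have "card (insert t T) \<le> Suc (Suc d)"
    using T card_insert_le_m1[of "Suc (Suc d)" T t] by simp
  ultimately show ?case
    using T(1) by (intro exI[of _ "insert t T"]) auto
qed

section \<open>Universal testing sets on the moment curve\<close>

definition moment_curve :: "nat \<Rightarrow> rat \<Rightarrow> nat \<Rightarrow> rat" where
  "moment_curve n t = (\<lambda>i\<in>{..<n}. t ^ Suc i)"

lemma moment_curve_in_rat_space: "moment_curve n t \<in> rat_space n"
  by (auto simp: moment_curve_def rat_space_def)

lemma inj_moment_curve:
  assumes "n \<ge> 1"
  shows "inj (moment_curve n)"
proof (rule injI)
  fix t u assume "moment_curve n t = moment_curve n u"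
  from fun_cong[OF this, of 0] show "t = u"
    using assms by (simp add: moment_curve_def)
qed

lemma finite_roots_power_sum:
  fixes w :: "nat \<Rightarrow> 'a::idom"
  assumes "i \<le> n" "w i \<noteq> 0"
  shows "finite {t. (\<Sum>j\<le>n. w j * t ^ j) = 0}"
proof -
  define p where "p = (\<Sum>j\<le>n. monom (w j) j)"
  have "coeff p i = w i"
    using assms(1) by (simp add: p_def coeff_sum sum.delta)
  then have "p \<noteq> 0" using assms(2) by auto
  then have "finite {t. poly p t = 0}" by (rule poly_roots_finite)
  then show ?thesis by (simp add: p_def poly_sum poly_monom)
qed

lemma vector_space_fun: "vector_space (\<lambda>(c::'a::field) (y::'b \<Rightarrow> 'a) x. c * y x)"
  by unfold_locales (auto simp: fun_eq_iff algebra_simps)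

lemma finite_support_in_span_units:
  fixes y :: "'b \<Rightarrow> 'a::field"
  assumes "finite I" "\<And>x. x \<notin> I \<Longrightarrow> y x = 0"
  shows "y \<in> module.span (\<lambda>c y x. c * y x) ((\<lambda>x z. if z = x then 1 else 0) ` I)"
  using assms
proof (induction I arbitrary: y rule: finite_induct)
  case empty
  interpret vector_space "\<lambda>(c::'a) (y::'b \<Rightarrow> 'a) x. c * y x" by (rule vector_space_fun)
  have "y = 0" using empty by (auto simp: fun_eq_iff)
  then show ?case using span_zero by metis
next
  case (insert x I)
  interpret vector_space "\<lambda>(c::'a) (y::'b \<Rightarrow> 'a) x. c * y x" by (rule vector_space_fun)
  let ?U = "(\<lambda>x z. if z = x then 1 else 0 :: 'a) ` insert x I"
  have "y(x := 0) \<in> span ((\<lambda>x z. if z = x then 1 else 0) ` I)"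
    using insert.prems by (intro insert.IH) auto
  moreover have "span ((\<lambda>x z. if z = x then 1 else 0) ` I) \<subseteq> span ?U"
    by (rule span_mono) blast
  ultimately have "y(x := 0) \<in> span ?U" by (rule rev_subsetD)
  moreover have "(\<lambda>z. y x * (if z = x then 1 else 0)) \<in> span ?U"
    by (intro span_scale span_base) auto
  ultimately have "(\<lambda>z. y x * (if z = x then 1 else 0)) + y(x := 0) \<in> span ?U"
    by (intro span_add)
  also have "(\<lambda>z. y x * (if z = x then 1 else 0)) + y(x := 0) = y"
    by (auto simp: fun_eq_iff)
  finally show ?case .
qed

text \<open>The coordinates of a monomial, indexed by the powers of \<open>t\<close> that they multiply on the
  moment curve.\<close>

definition homog_coord :: "trop_poly \<Rightarrow> (nat \<Rightarrow> rat) \<Rightarrow> nat \<Rightarrow> rat" where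
  "homog_coord p J i = (case i of 0 \<Rightarrow> the (p J) | Suc i' \<Rightarrow> J i')"

lemma monomial_val_moment_curve:
  "monomial_val n p J (moment_curve n t) = (\<Sum>i\<le>n. homog_coord p J i * t ^ i)"
proof -
  have "(\<Sum>i\<le>n. homog_coord p J i * t ^ i)
      = homog_coord p J 0 * t ^ 0 + (\<Sum>i<n. homog_coord p J (Suc i) * t ^ Suc i)"
    by (rule sum.atMost_shift)
  then show ?thesis
    by (simp add: monomial_val_def moment_curve_def homog_coord_def)
qed

text \<open>Take the parameter that \<open>ex_generic_parameters\<close> provides for the labelled coordinate vector
  of a polynomial \<open>p\<close>. Two monomials of \<open>p\<close> that agree there agree along the whole
  moment curve, hence have the same coordinates, contrary to having distinct exponent vectors. Points added to reach the
  size \<open>s\<close> do no harm.\<close>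

lemma ex_universal_testing_set:
  assumes n: "n \<ge> 1" and s: "k * (n + 1) < s"
  shows "\<exists>S. universal_testing_set n k S \<and> card S = s"
proof -
  define scale where "scale = (\<lambda>(c::rat) (y::nat \<times> nat \<Rightarrow> rat) x. c * y x)"
  interpret vector_space scale
    unfolding scale_def by (rule vector_space_fun)
  define \<phi> where
    "\<phi> = (\<lambda>(u, v) t (y :: nat \<times> nat \<Rightarrow> rat). \<Sum>i\<le>n. (y (u, i) - y (v, i)) * t ^ i)"
  define E where "E = {..<k} \<times> {..<k}"
  define B where "B = (\<lambda>x z. if z = x then 1 else 0 :: rat) ` ({..<k} \<times> {..n})"
  have "card B \<le> k * (n + 1)"
    unfolding B_def by (rule le_trans[OF card_image_le]) auto
  moreover have "finite B" by (simp add: B_def)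
  moreover have "Vector_Spaces.linear scale (*) (\<phi> e t)" for e t
  proof -
    have "\<phi> e t (y + z) = \<phi> e t y + \<phi> e t z" for y z
      by (cases e) (simp add: \<phi>_def algebra_simps sum.distrib sum_subtractf)
    moreover have "\<phi> e t (scale c y) = c * \<phi> e t y" for c y
      by (cases e) (simp add: \<phi>_def scale_def sum_distrib_left algebra_simps)
    moreover have "vector_space ((*) :: rat \<Rightarrow> rat \<Rightarrow> rat)"
      by unfold_locales (auto simp: algebra_simps)
    ultimately show ?thesis
      by (simp add: Vector_Spaces.linear_iff vector_space_axioms)
  qed
  moreover have "finite {t. \<phi> e t y = 0}" if "\<phi> e t y \<noteq> 0" for e t y
  proof -
    obtain u v where e: "e = (u, v)" by (cases e)
    have "\<exists>i\<le>n. y (u, i) - y (v, i) \<noteq> 0"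
    proof (rule ccontr)
      assume "\<not> ?thesis"
      then have "\<phi> e t y = 0" by (auto simp: \<phi>_def e intro!: sum.neutral)
      with that show False by simp
    qed
    then show ?thesis
      using finite_roots_power_sum[where w = "\<lambda>i. y (u, i) - y (v, i)" and n = n]
      by (auto simp: \<phi>_def e)
  qed
  moreover have inf: "infinite (UNIV :: rat set)" by (rule infinite_UNIV_char_0)
  ultimately obtain T0 where T0: "finite T0" "card T0 \<le> Suc (k * (n + 1))"
    "\<And>y. y \<in> span B \<Longrightarrow> \<exists>t\<in>T0. \<forall>e\<in>E. \<phi> e t y = 0 \<longrightarrow> (\<forall>t'. \<phi> e t' y = 0)"
    using ex_generic_parameters[of E \<phi> "{B}" "k * (n + 1)"] by (auto simp: E_def)
  have "infinite (UNIV - T0)" using inf T0(1) by (rule Diff_infinite_finite[rotated])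
  then obtain T1 where T1: "finite T1" "card T1 = s - card T0" "T1 \<subseteq> UNIV - T0"
    using infinite_arbitrarily_large by blast
  define T where "T = T0 \<union> T1"
  have "card T = s"
    unfolding T_def using T0 T1 s by (subst card_Un_disjoint) auto
  define S where "S = moment_curve n ` T"
  have "card S = s"
    unfolding S_def using \<open>card T = s\<close> inj_moment_curve[OF n]
    by (simp add: card_image inj_on_subset)
  moreover have "universal_testing_set n k S"
    unfolding universal_testing_set_def
  proof (intro conjI allI impI)
    show "finite S" using T0 T1 by (simp add: S_def T_def)
    show "S \<subseteq> rat_space n" by (auto simp: S_def moment_curve_in_rat_space)
    fix p assume p: "is_trop_poly n p \<and> nontrivial p \<and> card (dom p) \<le> k"
    then have "finite (dom p)" "dom p \<subseteq> rat_space n" by (auto simp: is_trop_poly_def)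
    then obtain g where g: "inj_on g (dom p)" "g ` dom p \<subseteq> {..<k}"
      using p card_le_inj[of "dom p" "{..<k}"] by auto
    \<comment> \<open>A label not used by \<open>p\<close> gets arbitrary coordinates; only the labels \<open>g J\<close> matter.\<close>
    define y where "y = (\<lambda>(u, i). if u < k \<and> i \<le> n
      then homog_coord p (inv_into (dom p) g u) i else 0)"
    have y: "y (g J, i) = homog_coord p J i" if "J \<in> dom p" "i \<le> n" for J i
      using that g by (auto simp: y_def)
    have "y \<in> span B"
      unfolding scale_def B_def
      by (rule finite_support_in_span_units) (auto simp: y_def split: if_splits)
    then obtain t where t: "t \<in> T"
      "\<And>e. e \<in> E \<Longrightarrow> \<phi> e t y = 0 \<Longrightarrow> (\<forall>t'. \<phi> e t' y = 0)"
      using T0(3) unfolding T_def by blast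
    have "\<not> trop_root n p (moment_curve n t)"
    proof
      assume "trop_root n p (moment_curve n t)"
      then obtain J K where JK: "J \<in> dom p" "K \<in> dom p" "J \<noteq> K"
        "monomial_val n p J (moment_curve n t) = monomial_val n p K (moment_curve n t)"
        unfolding trop_root_def by metis
      have \<phi>: "\<phi> (g J, g K) t' y
          = (\<Sum>i\<le>n. (homog_coord p J i - homog_coord p K i) * t' ^ i)" for t'
        unfolding \<phi>_def prod.case using JK by (intro sum.cong) (auto simp: y)
      have "\<phi> (g J, g K) t y = 0"
        using JK(4) by (simp add: \<phi> monomial_val_moment_curve left_diff_distrib sum_subtractf)
      then have "\<forall>t'. \<phi> (g J, g K) t' y = 0"
        using JK g by (intro t(2)) (auto simp: E_def)
      then have "infinite {t'. \<phi> (g J, g K) t' y = 0}" using inf by simp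
      then have eq: "homog_coord p J i = homog_coord p K i" if "i \<le> n" for i
        using that finite_roots_power_sum[of i n "\<lambda>i. homog_coord p J i - homog_coord p K i"]
        unfolding \<phi> by auto
      have "J i = K i" if "i < n" for i
        using eq[of "Suc i"] that by (simp add: homog_coord_def)
      then have "J = K"
        using JK \<open>dom p \<subseteq> rat_space n\<close> unfolding rat_space_def
        by (intro PiE_ext[of J "{..<n}" "\<lambda>_. UNIV" K]) auto
      with JK show False by simp
    qed
    then show "\<exists>a\<in>S. \<not> trop_root n p a"
      using t(1) by (auto simp: S_def)
  qed
  ultimately show ?thesis by blast
qed

section \<open>A polynomial vanishing on a given finite set\<close>

text \<open>With \<open>R\<close> the set of first coordinates, the piecewise linear convex function
  \<open>x \<mapsto> (\<Sum>r\<in>R. max 0 (x 0 - r))\<close> has a kink wherever \<open>x 0\<close> lies in \<open>R\<close>. Its linear pieces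
  are the sums of \<open>x 0 - r\<close> over the initial segments of \<open>R\<close>; these segments form a chain and so are
  told apart by their cardinality, which is the exponent of \<open>x 0\<close>.\<close>

lemma ex_trop_poly_vanishing:
  assumes n: "n \<ge> 1" and S: "finite S"
  shows "\<exists>p. is_trop_poly n p \<and> nontrivial p \<and> card (dom p) \<le> card S + 1 \<and>
    (\<forall>a\<in>S. trop_root n p a)"
proof -
  define R where "R = (\<lambda>a. a 0) ` S"
  have R: "finite R" "card R \<le> card S"
    using S by (auto simp: R_def card_image_le)
  \<comment> \<open>the initial segments of \<open>R\<close>\<close>
  define D where "D = {A. A \<subseteq> R \<and> (\<forall>r\<in>A. \<forall>r'\<in>R. r' \<le> r \<longrightarrow> r' \<in> A)}"
  have "finite D"
    unfolding D_def using R by auto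
  have finD: "finite A" if "A \<in> D" for A
    using that R finite_subset by (auto simp: D_def)
  have inj_card: "inj_on card D"
  proof (rule inj_onI)
    fix A A' assume A: "A \<in> D" "A' \<in> D" and c: "card A = card A'"
    have "A \<subseteq> A' \<or> A' \<subseteq> A"
    proof (rule ccontr)
      assume "\<not> ?thesis"
      then obtain r r' where "r \<in> A" "r \<notin> A'" "r' \<in> A'" "r' \<notin> A" by blast
      then show False
        using A unfolding D_def by (cases "r \<le> r'") auto
    qed
    then show "A = A'"
      using card_subset_eq finD A c by metis
  qed
  define e where "e = (\<lambda>A :: rat set. (\<lambda>i\<in>{..<n}. if i = 0 then of_nat (card A) else 0 :: rat))"
  have inj_e: "inj_on e D"
  proof (rule inj_onI)
    fix A A' assume A: "A \<in> D" "A' \<in> D" and "e A = e A'"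
    from fun_cong[OF this(3), of 0] have "card A = card A'"
      using n by (simp add: e_def)
    then show "A = A'" using inj_card A by (auto dest: inj_onD)
  qed
  define p where "p = (\<lambda>J. if J \<in> e ` D then Some (- \<Sum>(inv_into D e J)) else None)"
  have dom_p: "dom p = e ` D" by (auto simp: p_def dom_def)
  have val: "monomial_val n p (e A) a = (\<Sum>r\<in>A. a 0 - r)" if "A \<in> D" for A a
  proof -
    have "(\<Sum>i<n. e A i * a i) = (\<Sum>i<n. if i = 0 then of_nat (card A) * a 0 else 0)"
      by (rule sum.cong) (auto simp: e_def)
    also have "\<dots> = of_nat (card A) * a 0" using n by simp
    finally show ?thesis
      using that inj_e by (simp add: monomial_val_def p_def sum_subtractf)
  qed
  have root: "trop_root n p a" if "a \<in> S" for a
  proof -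
    define q where "q = a 0"
    \<comment> \<open>The two pieces that meet at \<open>q\<close>; they differ in the summand for \<open>q\<close>, which vanishes there.\<close>
    define L where "L = {r \<in> R. r < q}"
    define M where "M = {r \<in> R. r \<le> q}"
    have q: "q \<in> R" using that by (auto simp: q_def R_def)
    have LD: "L \<in> D" and MD: "M \<in> D" by (auto simp: L_def M_def D_def)
    have "M = insert q L" "q \<notin> L" using q by (auto simp: L_def M_def)
    then have "e L \<noteq> e M"
      using inj_e LD MD by (metis inj_onD insertI1)
    have vM: "monomial_val n p (e M) a = monomial_val n p (e L) a"
      using \<open>M = insert q L\<close> \<open>q \<notin> L\<close> LD MD finD by (simp add: val q_def)
    have le: "monomial_val n p (e A) a \<le> monomial_val n p (e L) a" if "A \<in> D" for A
    proof -
      have A: "finite A" "A \<subseteq> R" using that finD by (auto simp: D_def)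
      have "(\<Sum>r\<in>A. q - r) \<le> (\<Sum>r\<in>A. if r < q then q - r else 0)"
        by (rule sum_mono) auto
      also have "\<dots> = (\<Sum>r\<in>{r\<in>A. r < q}. q - r)"
        using A by (simp add: sum.inter_filter)
      also have "\<dots> \<le> (\<Sum>r\<in>L. q - r)"
        using A R by (intro sum_mono2) (auto simp: L_def)
      finally show ?thesis using that LD by (simp add: val q_def)
    qed
    have "trop_val n p a = monomial_val n p (e L) a"
      unfolding trop_val_def dom_p using \<open>finite D\<close> LD le by (intro Max_eqI) auto
    then show ?thesis
      unfolding trop_root_def dom_p using LD MD \<open>e L \<noteq> e M\<close> vM by (metis imageI)
  qed
  have "card ` D \<subseteq> {..card R}"
    using R by (auto simp: D_def card_mono)
  then have "card (card ` D) \<le> card {..card R}" by (intro card_mono) auto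
  then have "card D \<le> card R + 1"
    using inj_card by (simp add: card_image)
  then have "card (dom p) \<le> card S + 1"
    using R inj_e by (simp add: dom_p card_image)
  moreover have "{} \<in> D" by (simp add: D_def)
  then have "nontrivial p" by (auto simp: nontrivial_def dom_p)
  moreover have "is_trop_poly n p"
    using \<open>finite D\<close> by (auto simp: is_trop_poly_def dom_p e_def rat_space_def split: if_splits)
  ultimately show ?thesis using root by blast
qed

theorem theorem13:
  fixes n :: nat
  assumes "n \<ge> 1"
  shows "(\<forall>s::nat. int (min_monomials s n) \<ge> \<lceil>real s / real (n + 1)\<rceil>) \<and>
         (\<forall>k::nat. k \<ge> 1 \<longrightarrow>
            (\<exists>S. universal_testing_set n k S) \<and> min_testing_size n k \<le> k * (n + 1) + 1)"
proof (intro conjI allI impI)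
  fix s :: nat
  let ?k = "min_monomials s n"
  have vanishing: "\<forall>S. S \<subseteq> rat_space n \<and> finite S \<and> card S = s \<longrightarrow>
      (\<exists>p. is_trop_poly n p \<and> nontrivial p \<and> card (dom p) \<le> ?k \<and> (\<forall>a\<in>S. trop_root n p a))"
    unfolding min_monomials_def
    by (rule LeastI[where k = "s + 1"]) (use ex_trop_poly_vanishing[OF assms] in blast)
  have "s \<le> ?k * (n + 1)"
  proof (rule ccontr)
    assume "\<not> ?thesis"
    then have "?k * (n + 1) < s" by (rule not_le_imp_less)
    from ex_universal_testing_set[OF assms this]
    obtain S where S: "universal_testing_set n ?k S" "card S = s" by blast
    then have "S \<subseteq> rat_space n" "finite S"
      by (simp_all add: universal_testing_set_def)
    with vanishing S(2) have
      "\<exists>p. is_trop_poly n p \<and> nontrivial p \<and> card (dom p) \<le> ?k \<and> (\<forall>a\<in>S. trop_root n p a)"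
      by presburger
    with S(1) show False
      unfolding universal_testing_set_def by meson
  qed
  then have "real s \<le> real (?k * (n + 1))" by (simp only: of_nat_le_iff)
  then have "real s / real (n + 1) \<le> real ?k"
    by (simp add: pos_divide_le_eq distrib_left)
  then show "int ?k \<ge> \<lceil>real s / real (n + 1)\<rceil>"
    by (simp add: ceiling_le_iff)
next
  fix k :: nat
  obtain S where S: "universal_testing_set n k S" "card S = k * (n + 1) + 1"
    using ex_universal_testing_set[OF assms, of k "k * (n + 1) + 1"] by auto
  then show "\<exists>S. universal_testing_set n k S" by blast
  show "min_testing_size n k \<le> k * (n + 1) + 1"
    unfolding min_testing_size_def using S by (intro Least_le) blast
qed

end
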